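(* Let $Y$ be a proper nonempty subset of $X$ with $\chi_Y\in V_0\oplus V_2\oplus V_3$. Then $\chi_Y\in V_0\oplus V_2$ if and only if $Y^\sigma=Y$, and $\chi_Y\in V_0\oplus V_3$ if and only if $Y$ contains exactly one of the two points $p,p^\sigma$ for every $p\in X$.
   Context: Let $q>2$ be a prime power. Let $\mathcal Q$ be an elliptic quadric $\mathsf{Q}^-(5,q)$ in $\mathrm{PG}(5,q)$ with associated polarity $\perp$, $H$ a hyperplane with $H\cap\mathcal Q$ a parabolic quadric $\mathsf Q(4,q)$, $X:=\mathcal Q\setminus H$. Points $u,v\in\mathcal Q$ are collinear ($u\sim v$) if $u\ne v$ and $v\in u^\perp$. For $p\in X$, $p^\sigma$ is the unique point of $\mathcal Q$ other than $p$ on the line joining $H^\perp$ and $p$; $Y^\sigma=\{y^\sigma:y\in Y\}$. Relations on $X$: $R_0=\{(u,v):u=v\}$, $R_1=\{(u,v): v\not\sim u\sim v^\sigma\}$, $R_2=\{(u,v): v\not\sim u\not\sim v^\sigma\}$, $R_3=\{(u,v): v\sim u\not\sim v^\sigma\}$, $R_4=\{(u,v):u=v^\sigma\}$, adjacency matrices $A_0,\dots,A_4$. They form a symmetric association scheme; $\mathbb R^X$ is the orthogonal sum of common eigenspaces $V_0,\dots,V_4$ ($V_0=\langle j\rangle$), numbered so that $A_kv=P_{ik}v$ for $v\in V_i$, with $P=\begin{pmatrix}1&(q-1)(q^2+1)&(q-2)q(q^2+1)&(q-1)(q^2+1)&1\\1&q^2+1&0&-(q^2+1)&-1\\1&q-1&-2q&q-1&1\\1&-(q-1)&0&q-1&-1\\1&-(q-1)^2&2(q-2)q&-(q-1)^2&1\end{pmatrix}$.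 $\chi_Y$ is the characteristic vector of $Y$.
   Formalization: R_2 is taken to exclude the pairs with u = v or u = v^σ: as literally defined it contains R_0 and R_4, so the relations would not be disjoint and A_2 would not have the eigenvalues in P; with these pairs removed the scheme and P are as stated. *)

theory Defs
  imports "HOL-Analysis.Analysis"
begin

text \<open>The ground field is a finite field \<open>'a\<close> of order \<open>q = CARD('a)\<close>, and a subspace of
  \<open>PG(5,q)\<close> is represented by the corresponding linear subspace of \<open>'a ^ 6\<close>;
  projective dimensions are therefore one less than the \<open>vec.dim\<close> appearing below.\<close>

type_synonym 'a subsp = "('a ^ 6) set"

definition is_point :: "'a::{field,finite} subsp \<Rightarrow> bool" where
  "is_point p \<longleftrightarrow> vec.subspace p \<and> vec.dim p = 1"

definition is_hyperplane :: "'a::{field,finite} subsp \<Rightarrow> bool" where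
  "is_hyperplane H \<longleftrightarrow> vec.subspace H \<and> vec.dim H = 5"

definition join :: "'a::{field,finite} subsp \<Rightarrow> 'a subsp \<Rightarrow> 'a subsp" where
  "join S T = vec.span (S \<union> T)"


definition polar :: "('a::{field,finite} ^ 6 \<Rightarrow> 'a) \<Rightarrow> 'a ^ 6 \<Rightarrow> 'a ^ 6 \<Rightarrow> 'a" where
  "polar Q u v = Q (u + v) - Q u - Q v"

text \<open>As \<open>polar Q\<close> is symmetric, linearity in the second argument is bilinearity.\<close>

definition quadratic_form :: "('a::{field,finite} ^ 6 \<Rightarrow> 'a) \<Rightarrow> bool" where
  "quadratic_form Q \<longleftrightarrow>
     (\<forall>c v. Q (c *s v) = c\<^sup>2 * Q v) \<and>
     (\<forall>u. Vector_Spaces.linear (*s) (*) (polar Q u))"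

text \<open>Non-degeneracy of the restriction of \<open>Q\<close> to \<open>W\<close>, i.e. the quadric it defines in \<open>W\<close> has no
  singular point. In characteristic 2 the radical of the polar form on \<open>W\<close> may still
  be nonzero; for the parabolic quadric \<open>Q(4,q)\<close> with \<open>q\<close> even it is the nucleus.\<close>

definition nondegenerate_on :: "('a::{field,finite} ^ 6 \<Rightarrow> 'a) \<Rightarrow> 'a subsp \<Rightarrow> bool" where
  "nondegenerate_on Q W \<longleftrightarrow>
     (\<forall>w\<in>W. Q w = 0 \<and> (\<forall>w'\<in>W. polar Q w w' = 0) \<longrightarrow> w = 0)"

definition totally_singular :: "('a::{field,finite} ^ 6 \<Rightarrow> 'a) \<Rightarrow> 'a subsp \<Rightarrow> bool" where
  "totally_singular Q W \<longleftrightarrow> vec.subspace W \<and> (\<forall>w\<in>W. Q w = 0)"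

definition witt_index :: "('a::{field,finite} ^ 6 \<Rightarrow> 'a) \<Rightarrow> nat" where
  "witt_index Q = Max (vec.dim ` {W. totally_singular Q W})"

text \<open>A non-degenerate quadric of \<open>PG(5,q)\<close> is hyperbolic (Witt index 3) or elliptic (Witt index 2).\<close>

definition elliptic_form :: "('a::{field,finite} ^ 6 \<Rightarrow> 'a) \<Rightarrow> bool" where
  "elliptic_form Q \<longleftrightarrow> quadratic_form Q \<and> nondegenerate_on Q UNIV \<and> witt_index Q = 2"

text \<open>In a projective space of dimension 4, the non-degenerate quadrics are the parabolic ones.\<close>

definition parabolic_hyperplane :: "('a::{field,finite} ^ 6 \<Rightarrow> 'a) \<Rightarrow> 'a subsp \<Rightarrow> bool" where
  "parabolic_hyperplane Q H \<longleftrightarrow> is_hyperplane H \<and> nondegenerate_on Q H"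

definition quadric :: "('a::{field,finite} ^ 6 \<Rightarrow> 'a) \<Rightarrow> 'a subsp set" where
  "quadric Q = {p. is_point p \<and> totally_singular Q p}"

definition perp :: "('a::{field,finite} ^ 6 \<Rightarrow> 'a) \<Rightarrow> 'a subsp \<Rightarrow> 'a subsp" where
  "perp Q S = {w. \<forall>s\<in>S. polar Q s w = 0}"

definition collinear_pts :: "('a::{field,finite} ^ 6 \<Rightarrow> 'a) \<Rightarrow> 'a subsp \<Rightarrow> 'a subsp \<Rightarrow> bool" where
  "collinear_pts Q u v \<longleftrightarrow> u \<noteq> v \<and> v \<subseteq> perp Q u"


definition X_set :: "('a::{field,finite} ^ 6 \<Rightarrow> 'a) \<Rightarrow> 'a subsp \<Rightarrow> 'a subsp set" where
  "X_set Q H = {p \<in> quadric Q. \<not> p \<subseteq> H}"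

text \<open>The map \<open>p \<mapsto> p\<^sup>\<sigma>\<close> on \<open>X\<close>.\<close>

definition antipode :: "('a::{field,finite} ^ 6 \<Rightarrow> 'a) \<Rightarrow> 'a subsp \<Rightarrow> 'a subsp \<Rightarrow> 'a subsp" where
  "antipode Q H p = (THE r. r \<in> quadric Q \<and> r \<noteq> p \<and> r \<subseteq> join (perp Q H) p)"

text \<open>The condition \<open>v \<not>\<sim> u \<not>\<sim> v\<^sup>\<sigma>\<close> for \<open>R\<^sub>2\<close> also holds for \<open>u = v\<close> and \<open>u = v\<^sup>\<sigma>\<close>, as no point is
  collinear with itself. These pairs constitute \<open>R\<^sub>0\<close> and \<open>R\<^sub>4\<close> and are excluded from \<open>R\<^sub>2\<close>, so
  that the relations partition \<open>X \<times> X\<close>.\<close>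

definition rel :: "('a::{field,finite} ^ 6 \<Rightarrow> 'a) \<Rightarrow> 'a subsp \<Rightarrow> nat \<Rightarrow> ('a subsp \<times> 'a subsp) set" where
  "rel Q H k = {(u, v). u \<in> X_set Q H \<and> v \<in> X_set Q H \<and>
     [u = v,
      \<not> collinear_pts Q u v \<and> collinear_pts Q u (antipode Q H v),
      \<not> collinear_pts Q u v \<and> \<not> collinear_pts Q u (antipode Q H v) \<and> u \<noteq> v \<and> u \<noteq> antipode Q H v,
      collinear_pts Q u v \<and> \<not> collinear_pts Q u (antipode Q H v),
      u = antipode Q H v] ! k}"

definition adj :: "('a::{field,finite} ^ 6 \<Rightarrow> 'a) \<Rightarrow> 'a subsp \<Rightarrow> nat \<Rightarrow> 'a subsp \<Rightarrow> 'a subsp \<Rightarrow> real" where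
  "adj Q H k u v = of_bool ((u, v) \<in> rel Q H k)"

definition eigenmatrix :: "real \<Rightarrow> nat \<Rightarrow> nat \<Rightarrow> real" where
  "eigenmatrix q i k =
    [[1, (q - 1) * (q\<^sup>2 + 1), (q - 2) * q * (q\<^sup>2 + 1), (q - 1) * (q\<^sup>2 + 1), 1],
     [1, q\<^sup>2 + 1, 0, - (q\<^sup>2 + 1), - 1],
     [1, q - 1, - 2 * q, q - 1, 1],
     [1, - (q - 1), 0, q - 1, - 1],
     [1, - (q - 1)\<^sup>2, 2 * (q - 2) * q, - (q - 1)\<^sup>2, 1]] ! i ! k"

text \<open>Vectors of \<open>\<real>\<^sup>X\<close> are represented by real functions vanishing outside \<open>X\<close>.\<close>

definition eigspace :: "('a::{field,finite} ^ 6 \<Rightarrow> 'a) \<Rightarrow> 'a subsp \<Rightarrow> nat \<Rightarrow> ('a subsp \<Rightarrow> real) set" where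
  "eigspace Q H i = {f. (\<forall>u. u \<notin> X_set Q H \<longrightarrow> f u = 0) \<and>
     (\<forall>k\<le>4. \<forall>u\<in>X_set Q H.
        (\<Sum>v\<in>X_set Q H. adj Q H k u v * f v) = eigenmatrix (real CARD('a)) i k * f u)}"

text \<open>The sum of the spaces \<open>V\<^sub>i\<close>, \<open>i \<in> I\<close>.\<close>

definition eigsum :: "('a::{field,finite} ^ 6 \<Rightarrow> 'a) \<Rightarrow> 'a subsp \<Rightarrow> nat set \<Rightarrow> ('a subsp \<Rightarrow> real) set" where
  "eigsum Q H I = {f. \<exists>g. (\<forall>i\<in>I. g i \<in> eigspace Q H i) \<and> f = (\<lambda>u. \<Sum>i\<in>I. g i u)}"

end

theory Submission
  imports Defs
begin

text \<open>Let \<open>n\<close> span the pole of \<open>H\<close>. The map \<open>\<sigma>\<close> is induced by the reflection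
  \<open>x \<mapsto> x - (B n x / Q n) n\<close>, an involution on \<open>X\<close>. The matrix \<open>A\<^sub>4\<close> is composition with \<open>\<sigma>\<close>, with
  eigenvalues \<open>1, 1, -1\<close> on \<open>V\<^sub>0, V\<^sub>2, V\<^sub>3\<close>, so the component of \<open>\<chi>\<^sub>Y\<close> in \<open>V\<^sub>3\<close> vanishes iff \<open>\<chi>\<^sub>Y\<close> is
  \<open>\<sigma>\<close>-invariant. The sum of all \<open>A\<^sub>k\<close> is the all-one matrix, so \<open>V\<^sub>0\<close> consists of constants and the
  vectors in \<open>V\<^sub>2\<close> have sum zero; hence the component in \<open>V\<^sub>2\<close> vanishes iff \<open>\<chi>\<^sub>Y + \<chi>\<^sub>Y \<circ> \<sigma>\<close> is
  constant on \<open>X\<close>, and for \<open>\<emptyset> \<noteq> Y \<noteq> X\<close> this constant must be \<open>1\<close>.\<close>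

lemma one_less_card_field: "1 < CARD('a::{field,finite})"
proof -
  have "card {0, 1 :: 'a} \<le> CARD('a)" by (intro card_mono) auto
  then show ?thesis by simp
qed

section \<open>Quadratic forms, their polar forms and poles of hyperplanes\<close>

locale quadratic_space =
  fixes Q :: "'a::{field,finite} ^ 6 \<Rightarrow> 'a"
  assumes quadratic: "quadratic_form Q"
begin

abbreviation B :: "'a ^ 6 \<Rightarrow> 'a ^ 6 \<Rightarrow> 'a" where "B \<equiv> polar Q"

lemma Q_scale: "Q (c *s v) = c\<^sup>2 * Q v"
  using quadratic by (simp add: quadratic_form_def)

lemma Q_zero [simp]: "Q 0 = 0"
  using Q_scale[of 0 0] by simp

lemma Q_add: "Q (u + v) = Q u + Q v + B u v"
  by (simp add: polar_def)

lemma B_linear: "Vector_Spaces.linear (*s) (*) (B u)"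
  using quadratic by (simp add: quadratic_form_def)

lemma B_sym: "B u v = B v u"
  by (simp add: polar_def add.commute)

lemma B_add_right: "B u (v + w) = B u v + B u w"
  by (rule Vector_Spaces.linear.axioms(3)[OF B_linear, THEN module_hom.add])

lemma B_scale_right: "B u (c *s v) = c * B u v"
  by (rule Vector_Spaces.linear.axioms(3)[OF B_linear, THEN module_hom.scale])

lemma B_add_left: "B (v + w) u = B v u + B w u"
  using B_add_right B_sym by metis

lemma B_scale_left: "B (c *s v) u = c * B v u"
  using B_scale_right B_sym by metis

lemma B_diff_right: "B u (v - w) = B u v - B u w"
  by (metis B_add_right add_diff_cancel_right' diff_add_cancel)

lemma B_diff_left: "B (v - w) u = B v u - B w u"
  using B_diff_right B_sym by metis

lemma B_zero_right [simp]: "B u 0 = 0"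
  using B_diff_right[of u 0 0] by simp

lemma B_zero_left [simp]: "B 0 u = 0"
  using B_sym B_zero_right by metis

lemmas B_simps = B_add_right B_scale_right B_add_left B_scale_left B_diff_right B_diff_left

lemma B_self: "B v v = 2 * Q v"
proof -
  have "v + v = 2 *s v"
    by (simp add: vec_eq_iff)
  then show ?thesis by (simp add: polar_def Q_scale)
qed

text \<open>Hyperbolic pairs are split off one at a time; each contributes a factor
  \<open>CARD('a) ^ 2\<close>, and what finally remains is the radical. So the codimension of the
  radical is even.\<close>

lemma card_subspace_alternating:
  assumes alt: "\<And>v. B v v = 0" and "vec.subspace W"
  shows "\<exists>k. card W = card {w \<in> W. \<forall>v\<in>W. B w v = 0} * CARD('a) ^ (2 * k)"
  using assms(2)
proof (induction "card W" arbitrary: W rule: less_induct)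
  case less
  note W = less.prems
  show ?case
  proof (cases "\<forall>w\<in>W. \<forall>v\<in>W. B w v = 0")
    case True
    then have "{w \<in> W. \<forall>v\<in>W. B w v = 0} = W" by auto
    then show ?thesis by (intro exI[of _ 0]) simp
  next
    case False
    then obtain e0 f where ef0: "e0 \<in> W" "f \<in> W" "B e0 f \<noteq> 0" by blast
    define e where "e = inverse (B e0 f) *s e0"
    have eW: "e \<in> W" unfolding e_def using W ef0 by (simp add: vec.subspace_scale)
    have ef: "B e f = 1" unfolding e_def using ef0 by (simp add: B_scale_left)
    have fe: "B f e = 1" using ef B_sym by metis
    define W' where "W' = {w \<in> W. B e w = 0 \<and> B f w = 0}"
    have W': "vec.subspace W'"
      using W unfolding W'_def vec.subspace_def by (auto simp: B_simps)
    \<comment> \<open>Projection along the hyperbolic pair onto its orthogonal complement. The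
      coefficients are crossed because \<open>e\<close> and \<open>f\<close> pair with each other
      and, by \<open>alt\<close>, not with themselves.\<close>
    have decomp: "w - B f w *s e - B e w *s f \<in> W'" if "w \<in> W" for w
      using W eW \<open>f \<in> W\<close> that alt unfolding W'_def
      by (auto simp: B_simps ef fe vec.subspace_diff vec.subspace_scale)
    have "bij_betw (\<lambda>(a, b, w). a *s e + b *s f + w) (UNIV \<times> UNIV \<times> W') W"
    proof (rule bij_betw_byWitness[where f' = "\<lambda>w. (B f w, B e w, w - B f w *s e - B e w *s f)"])
      show "\<forall>x\<in>UNIV \<times> UNIV \<times> W'.
          (\<lambda>w. (B f w, B e w, w - B f w *s e - B e w *s f)) ((\<lambda>(a, b, w). a *s e + b *s f + w) x) = x"
        using alt by (auto simp: B_simps ef fe W'_def)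
      show "(\<lambda>(a, b, w). a *s e + b *s f + w) ` (UNIV \<times> UNIV \<times> W') \<subseteq> W"
        using W eW \<open>f \<in> W\<close> by (auto simp: W'_def vec.subspace_add vec.subspace_scale)
    qed (use decomp in auto)
    from bij_betw_same_card[OF this]
    have card: "card W = card W' * CARD('a) ^ 2"
      by (simp add: card_cartesian_product power2_eq_square mult_ac)
    have "f \<notin> W'" using ef by (simp add: W'_def)
    then have "W' \<subset> W" using \<open>f \<in> W\<close> by (auto simp: W'_def)
    then have "card W' < card W" by (intro psubset_card_mono) auto
    from less.hyps[OF this W'] obtain k
      where k: "card W' = card {w \<in> W'. \<forall>v\<in>W'. B w v = 0} * CARD('a) ^ (2 * k)" by blast
    \<comment> \<open>The radical survives the splitting: a vector of \<open>W'\<close> is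
      orthogonal to \<open>e\<close> and \<open>f\<close> by definition, so orthogonality to
      \<open>W'\<close> extends to all of \<open>W\<close>.\<close>
    have "{w \<in> W'. \<forall>v\<in>W'. B w v = 0} = {w \<in> W. \<forall>v\<in>W. B w v = 0}"
    proof (intro equalityI subsetI)
      fix r assume r: "r \<in> {w \<in> W'. \<forall>v\<in>W'. B w v = 0}"
      have "B r v = 0" if "v \<in> W" for v
      proof -
        have "B r (v - B f v *s e - B e v *s f) = 0" using r decomp[OF that] by simp
        moreover have "B r e = 0" "B r f = 0"
          using r B_sym[of r e] B_sym[of r f] by (auto simp: W'_def)
        ultimately show ?thesis by (simp add: B_simps)
      qed
      then show "r \<in> {w \<in> W. \<forall>v\<in>W. B w v = 0}" using r by (simp add: W'_def)
    next
      fix r assume "r \<in> {w \<in> W. \<forall>v\<in>W. B w v = 0}"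
      then show "r \<in> {w \<in> W'. \<forall>v\<in>W'. B w v = 0}"
        using eW \<open>f \<in> W\<close> B_sym[of e r] B_sym[of f r] by (auto simp: W'_def)
    qed
    with k card have "card W = card {w \<in> W. \<forall>v\<in>W. B w v = 0} * CARD('a) ^ (2 * Suc k)"
      by (simp add: power2_eq_square mult_ac)
    then show ?thesis by blast
  qed
qed

text \<open>In characteristic 2 the form \<open>Q\<close> is additive on the radical of \<open>B\<close> and injective there by
  non-degeneracy, so the radical has at most \<open>q\<close> elements; it cannot have exactly \<open>q\<close>, because the
  dimension 6 is even.\<close>

lemma polar_nondegenerate:
  assumes nondeg: "nondegenerate_on Q UNIV" and r: "\<And>v. B r v = 0"
  shows "r = 0"
proof (cases "(2::'a) = 0")
  case False
  then have "Q r = 0" using r[of r] by (simp add: B_self)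
  then show ?thesis using nondeg r by (auto simp: nondegenerate_on_def)
next
  case True
  define R where "R = {w. \<forall>v. B w v = 0}"
  have anisotropic: "w = 0" if "w \<in> R" "Q w = 0" for w
    using nondeg that by (auto simp: nondegenerate_on_def R_def)
  have R: "vec.subspace R"
    unfolding vec.subspace_def R_def by (auto simp: B_simps)
  have neg: "- x = x" for x :: 'a
  proof -
    have "x + x = 2 * x" by simp
    then show ?thesis using True by (simp add: eq_neg_iff_add_eq_0 minus_equation_iff)
  qed
  have "inj_on Q R"
  proof (rule inj_onI)
    fix u v assume uv: "u \<in> R" "v \<in> R" "Q u = Q v"
    have "Q (u - v) = Q (u + (-1) *s v)" by (simp add: vec_eq_iff)
    also have "\<dots> = Q u + Q v" using uv unfolding Q_add Q_scale B_simps by (simp add: R_def)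
    also have "\<dots> = 0" using uv neg[of "Q v"] by (metis add.right_inverse)
    finally show "u = v" using anisotropic[of "u - v"] R uv by (simp add: vec.subspace_diff)
  qed
  then have le: "card R \<le> CARD('a)" by (metis card_inj_on_le finite_class.finite_UNIV subset_UNIV)
  show ?thesis
  proof (rule ccontr)
    assume "r \<noteq> 0"
    have "inj (\<lambda>c. c *s r)" using \<open>r \<noteq> 0\<close> by (intro injI) simp
    moreover have "range (\<lambda>c. c *s r) \<subseteq> R" using r by (auto simp: R_def B_simps)
    ultimately have "CARD('a) \<le> card R" by (metis card_inj_on_le finite_code)
    with le have "card R = CARD('a)" by simp
    moreover obtain k where "CARD('a ^ 6) = card {w \<in> UNIV. \<forall>v\<in>UNIV. B w v = 0} * CARD('a) ^ (2 * k)"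
      using card_subspace_alternating[of UNIV] True by (auto simp: B_self)
    ultimately have "CARD('a) ^ 6 = CARD('a) ^ (Suc (2 * k))" by (simp add: R_def)
    moreover have "CARD('a) > 1" by (rule one_less_card_field)
    ultimately have "6 = Suc (2 * k)" using power_inject_exp by blast
    then show False by presburger
  qed
qed

text \<open>A nonzero \<open>n\<close> orthogonal to \<open>H\<close> is found by pigeonhole;
  comparing dimensions gives \<open>H\<close> as its orthogonal complement, and nondegeneracy of
  \<open>Q\<close> on \<open>H\<close> prevents \<open>n\<close> from being singular.\<close>

lemma parabolic_hyperplane_pole:
  assumes nondeg: "nondegenerate_on Q UNIV" and "parabolic_hyperplane Q H"
  obtains n where "perp Q H = vec.span {n}" "Q n \<noteq> 0" "H = {v. B n v = 0}"
proof -
  have H: "vec.subspace H" "vec.dim H = 5" and nondegH: "nondegenerate_on Q H"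
    using assms(2) by (auto simp: parabolic_hyperplane_def is_hyperplane_def)
  obtain b where b: "b \<subseteq> H" "H \<subseteq> vec.span b" "card b = 5"
    using vec.basis_exists[of H] H(2) by metis
  \<comment> \<open>A vector is recorded by its products with the five basis vectors of
    \<open>H\<close>. There are q^6 vectors and only q^5 records, so two vectors collide, and their
    difference is orthogonal to \<open>H\<close>.\<close>
  define \<phi> where "\<phi> = (\<lambda>w. restrict (B w) b)"
  have "\<not> inj \<phi>"
  proof
    assume "inj \<phi>"
    moreover have "range \<phi> \<subseteq> b \<rightarrow>\<^sub>E UNIV" by (auto simp: \<phi>_def)
    ultimately have "CARD('a ^ 6) \<le> card (b \<rightarrow>\<^sub>E (UNIV :: 'a set))"
      by (intro card_inj_on_le[of \<phi>]) (auto intro: finite_PiE)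
    then have "CARD('a) ^ 6 \<le> CARD('a) ^ 5" using b(3) by (simp add: card_PiE)
    then show False using one_less_card_field[where 'a='a] by simp
  qed
  then obtain w1 w2 where w: "w1 \<noteq> w2" "\<phi> w1 = \<phi> w2" by (auto simp: inj_def)
  define n where "n = w1 - w2"
  have "n \<noteq> 0" using w by (simp add: n_def)
  have "B n x = 0" if "x \<in> b" for x
    using fun_cong[OF w(2), of x] that by (simp add: \<phi>_def n_def B_simps)
  moreover have n_perp: "vec.subspace {v. B n v = 0}"
    by (auto simp: vec.subspace_def B_simps)
  ultimately have "vec.span b \<subseteq> {v. B n v = 0}" by (intro vec.span_minimal) auto
  with b have H_le: "H \<subseteq> {v. B n v = 0}" by blast
  obtain v where v: "B n v \<noteq> 0" using polar_nondegenerate[OF nondeg] \<open>n \<noteq> 0\<close> by blast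
  have H_eq: "H = {v. B n v = 0}"
  proof (rule vec.subspace_dim_equal[OF H(1) n_perp H_le])
    have "vec.dim {v. B n v = 0} < vec.dim (UNIV :: ('a ^ 6) set)"
    proof (rule vec.dim_psubset)
      have "vec.span {v. B n v = 0} = {v. B n v = 0}" using n_perp by (simp only: vec.span_eq_iff)
      moreover have "v \<notin> {v. B n v = 0}" using v by simp
      ultimately show "vec.span {v. B n v = 0} \<subset> vec.span UNIV"
        unfolding vec.span_UNIV by blast
    qed
    then show "vec.dim {v. B n v = 0} \<le> vec.dim H" using H(2) by (simp add: card_cart_basis)
  qed
  \<comment> \<open>\<open>H\<close> and \<open>v\<close> together span the whole space, so such an
    \<open>m\<close> lies in the radical of \<open>B\<close>.\<close>
  have ext: "m = 0" if "\<forall>h\<in>H. B m h = 0" "B m v = 0" for m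
  proof (rule polar_nondegenerate[OF nondeg])
    fix x
    have "x - (B n x / B n v) *s v \<in> H" using v by (simp add: H_eq B_simps)
    then have "B m (x - (B n x / B n v) *s v) = 0" using that(1) by blast
    then show "B m x = 0" using that(2) by (simp add: B_simps)
  qed
  have "perp Q H = vec.span {n}"
  proof (intro equalityI subsetI)
    fix m assume "m \<in> perp Q H"
    then have m: "\<forall>h\<in>H. B m h = 0" using B_sym by (auto simp: perp_def)
    \<comment> \<open>The multiple of \<open>n\<close> is chosen to make the difference orthogonal
      to \<open>v\<close> as well as to \<open>H\<close>.\<close>
    have "m - (B m v / B n v) *s n = 0"
      using m v H_eq by (intro ext) (auto simp: B_simps)
    then show "m \<in> vec.span {n}" by (auto simp: vec.span_singleton)
  next
    fix m assume "m \<in> vec.span {n}"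
    then show "m \<in> perp Q H"
      using H_eq B_sym by (auto simp: vec.span_singleton perp_def B_simps)
  qed
  moreover have "Q n \<noteq> 0"
  proof
    assume "Q n = 0"
    then have "n \<in> H" by (simp add: H_eq B_self)
    with \<open>Q n = 0\<close> nondegH \<open>n \<noteq> 0\<close> show False
      by (auto simp: nondegenerate_on_def H_eq)
  qed
  ultimately show thesis using H_eq that by blast
qed

end

section \<open>Points as spans of nonzero vectors\<close>

lemma span_scale_singleton:
  fixes x :: "'a::field ^ 'n"
  assumes "c \<noteq> 0"
  shows "vec.span {c *s x} = vec.span {x}"
proof (intro equalityI vec.span_minimal)
  have "x = inverse c *s (c *s x)" using assms by simp
  then show "{x} \<subseteq> vec.span {c *s x}"
    by (metis empty_subsetI insert_subset vec.span_base vec.span_scale singletonI)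
qed (auto simp: vec.span_base vec.span_scale)

lemma is_point_iff: "is_point p \<longleftrightarrow> (\<exists>x. x \<noteq> 0 \<and> p = vec.span {x})"
proof
  assume p: "is_point p"
  obtain b where b: "b \<subseteq> p" "vec.independent b" "p \<subseteq> vec.span b" "card b = 1"
    using vec.basis_exists[of p] p by (metis is_point_def)
  then obtain x where x: "b = {x}" by (meson card_1_singletonE)
  have "vec.span b \<subseteq> p" using b p by (simp add: is_point_def vec.span_minimal)
  with b x show "\<exists>x. x \<noteq> 0 \<and> p = vec.span {x}" by auto
next
  assume "\<exists>x. x \<noteq> 0 \<and> p = vec.span {x}"
  then obtain x where "x \<noteq> 0" "p = vec.span {x}" by blast
  then show "is_point p"
    using vec.dim_eq_card_independent[of "{x}"] by (simp add: is_point_def)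
qed

section \<open>The reflection in the pole and the map \<sigma>\<close>

locale hyperplane_pole = quadratic_space Q for Q :: "'a::{field,finite} ^ 6 \<Rightarrow> 'a" +
  fixes H :: "'a subsp" and n :: "'a ^ 6"
  assumes perp_H: "perp Q H = vec.span {n}"
    and Q_n: "Q n \<noteq> 0"
    and H_eq: "H = {v. B n v = 0}"
begin

abbreviation X :: "'a subsp set" where "X \<equiv> X_set Q H"

abbreviation \<sigma> :: "'a subsp \<Rightarrow> 'a subsp" where "\<sigma> \<equiv> antipode Q H"

text \<open>Since \<open>B n n = 2 * Q n\<close>, dividing by \<open>Q n\<close> gives the usual
  reflection in odd characteristic; in characteristic 2 the same formula is the orthogonal
  transvection.\<close>

definition reflection :: "'a ^ 6 \<Rightarrow> 'a ^ 6" where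
  "reflection x = x - (B n x / Q n) *s n"

lemma quadric_iff: "p \<in> quadric Q \<longleftrightarrow> (\<exists>x. x \<noteq> 0 \<and> p = vec.span {x} \<and> Q x = 0)"
proof -
  have "totally_singular Q (vec.span {x}) \<longleftrightarrow> Q x = 0" for x
    using vec.subspace_span[of "{x}"] vec.span_base[of x "{x}"]
    by (auto simp: totally_singular_def vec.span_singleton Q_scale)
  then show ?thesis by (auto simp: quadric_def is_point_iff)
qed

lemma X_iff: "p \<in> X \<longleftrightarrow> (\<exists>x. p = vec.span {x} \<and> Q x = 0 \<and> B n x \<noteq> 0)"
proof -
  have "vec.span {x} \<subseteq> H \<longleftrightarrow> B n x = 0" for x
    using vec.span_base[of x "{x}"] by (auto simp: H_eq vec.span_singleton B_simps)
  then show ?thesis by (fastforce simp: X_set_def quadric_iff)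
qed

lemma Q_reflection: "Q (reflection x) = Q x"
proof -
  have eq: "reflection x = x + (- (B n x / Q n)) *s n"
    by (simp add: reflection_def vec_eq_iff)
  have "Q (reflection x) = Q x + (B n x / Q n)\<^sup>2 * Q n - B n x / Q n * B x n"
    unfolding eq Q_add Q_scale B_simps by simp
  also have "B x n = B n x" by (rule B_sym)
  finally show ?thesis using Q_n by (simp add: power2_eq_square field_simps)
qed

lemma B_n_reflection: "B n (reflection x) = - B n x"
  using Q_n by (simp add: reflection_def B_simps B_self)

lemma reflection_reflection: "reflection (reflection x) = x"
  unfolding reflection_def[of "reflection x"] B_n_reflection
  by (simp add: reflection_def vec_eq_iff)

lemma B_reflection_self: "Q x = 0 \<Longrightarrow> B x (reflection x) = - (B n x)\<^sup>2 / Q n"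
  by (simp add: reflection_def B_simps B_self B_sym[of x n] power2_eq_square)

text \<open>If the reflection were a multiple of the singular vector \<open>x\<close>, its product
  with \<open>x\<close> would vanish, whereas it equals
  \<open>- (B n x)\<^sup>2 / Q n\<close>.\<close>

lemma span_reflection_neq:
  assumes "Q x = 0" "B n x \<noteq> 0"
  shows "vec.span {reflection x} \<noteq> vec.span {x}"
proof
  assume "vec.span {reflection x} = vec.span {x}"
  then have "reflection x \<in> vec.span {x}" using vec.span_base by blast
  then obtain c where "reflection x = c *s x" by (auto simp: vec.span_singleton)
  then show False
    using B_reflection_self[OF assms(1)] assms Q_n by (simp add: B_simps B_self)
qed

text \<open>On the line through the pole and \<open>x\<close>, the form factors as
  \<open>Q (a *s n + b *s x) = a * (a * Q n + b * B n x)\<close>. The factor \<open>a\<close> gives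
  the point of \<open>x\<close>, the other factor the point of its reflection.\<close>

lemma antipode_span:
  assumes x: "Q x = 0" "B n x \<noteq> 0"
  shows "\<sigma> (vec.span {x}) = vec.span {reflection x}"
proof -
  have join: "join (perp Q H) (vec.span {x}) = {a *s n + b *s x | a b. True}"
  proof -
    have "join (perp Q H) (vec.span {x}) = {v + w | v w. v \<in> vec.span {n} \<and> w \<in> vec.span {x}}"
      by (simp add: join_def perp_H vec.span_Un vec.span_span)
    then show ?thesis by (auto simp: vec.span_singleton)
  qed
  show ?thesis unfolding antipode_def join
  proof (rule the_equality)
    have "reflection x \<noteq> 0" using B_n_reflection[of x] x by auto
    then have "vec.span {reflection x} \<in> quadric Q"
      using Q_reflection[of x] x by (auto simp: quadric_iff)
    moreover have "c *s reflection x = (- c * (B n x / Q n)) *s n + c *s x" for c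
      by (simp add: reflection_def vec_eq_iff algebra_simps)
    then have "vec.span {reflection x} \<subseteq> {a *s n + b *s x | a b. True}"
      unfolding vec.span_singleton by blast
    ultimately show "vec.span {reflection x} \<in> quadric Q \<and> vec.span {reflection x} \<noteq> vec.span {x} \<and>
        vec.span {reflection x} \<subseteq> {a *s n + b *s x | a b. True}"
      using span_reflection_neq x by blast
  next
    fix r assume r: "r \<in> quadric Q \<and> r \<noteq> vec.span {x} \<and> r \<subseteq> {a *s n + b *s x | a b. True}"
    then obtain y where y: "y \<noteq> 0" "r = vec.span {y}" "Q y = 0" by (auto simp: quadric_iff)
    then have "y \<in> r" using vec.span_base by blast
    then obtain a b where ab: "y = a *s n + b *s x" using r by blast
    have "a \<noteq> 0"
    proof
      assume "a = 0"
      then have "y = b *s x" "b \<noteq> 0" using ab y by auto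
      then show False using r y span_scale_singleton[of b x] by simp
    qed
    have "a * (a * Q n + b * B n x) = Q y"
      unfolding ab Q_add Q_scale B_simps using x by (simp add: algebra_simps power2_eq_square)
    with y \<open>a \<noteq> 0\<close> have "a * Q n = - b * B n x" by (simp add: add_eq_0_iff2)
    then have a: "a = - b * (B n x / Q n)" using Q_n by (simp add: field_simps)
    then have "y = b *s reflection x"
      unfolding ab by (simp add: reflection_def vec_eq_iff algebra_simps)
    moreover from a \<open>a \<noteq> 0\<close> have "b \<noteq> 0" by auto
    ultimately show "r = vec.span {reflection x}" using y span_scale_singleton by metis
  qed
qed

lemma antipode_in_X: "p \<in> X \<Longrightarrow> \<sigma> p \<in> X"
  using B_n_reflection Q_reflection by (auto simp: X_iff antipode_span)

lemma antipode_antipode: "p \<in> X \<Longrightarrow> \<sigma> (\<sigma> p) = p"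
  using B_n_reflection Q_reflection by (auto simp: X_iff antipode_span reflection_reflection)

lemma antipode_neq: "p \<in> X \<Longrightarrow> \<sigma> p \<noteq> p"
  using span_reflection_neq by (auto simp: X_iff antipode_span)

section \<open>Collinearity and the adjacency matrices\<close>

lemma collinear_span_iff:
  "collinear_pts Q (vec.span {x}) (vec.span {y}) \<longleftrightarrow> vec.span {x} \<noteq> vec.span {y} \<and> B x y = 0"
proof -
  have "vec.span {y} \<subseteq> perp Q (vec.span {x}) \<longleftrightarrow> B x y = 0"
  proof
    assume "vec.span {y} \<subseteq> perp Q (vec.span {x})"
    then have "y \<in> perp Q (vec.span {x})" using vec.span_base by blast
    moreover have "x \<in> vec.span {x}" using vec.span_base by blast
    ultimately show "B x y = 0" by (auto simp: perp_def)
  qed (auto simp: perp_def vec.span_singleton B_simps)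
  then show ?thesis by (simp add: collinear_pts_def)
qed

lemma not_collinear_antipode: "p \<in> X \<Longrightarrow> \<not> collinear_pts Q p (\<sigma> p)"
  using Q_n by (auto simp: X_iff antipode_span collinear_span_iff B_reflection_self)

text \<open>For representatives \<open>x\<close> of \<open>u\<close> and \<open>y\<close> of
  \<open>v\<close>, the products of \<open>x\<close> with \<open>y\<close> and with its reflection
  differ by \<open>B n y * B n x / Q n\<close>, which is nonzero because neither point lies in
  \<open>H\<close>.\<close>

lemma not_both_collinear:
  assumes "u \<in> X" "v \<in> X"
  shows "\<not> (collinear_pts Q u v \<and> collinear_pts Q u (\<sigma> v))"
  using assms Q_n
  by (auto simp: X_iff antipode_span collinear_span_iff reflection_def B_simps B_sym[of _ n])

text \<open>The five relations partition the pairs of points of \<open>X\<close>. Off the diagonal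
  and off the antipodal pairs, the case of both collinearities is the only one to exclude.\<close>

lemma sum_adj:
  assumes "u \<in> X" "v \<in> X"
  shows "(\<Sum>k\<le>4. adj Q H k u v) = 1"
proof -
  have self: "\<not> collinear_pts Q v v" by (simp add: collinear_pts_def)
  have sum: "(\<Sum>k\<le>4. adj Q H k u v) =
      adj Q H 0 u v + adj Q H 1 u v + adj Q H 2 u v + adj Q H 3 u v + adj Q H 4 u v"
    by (simp add: eval_nat_numeral)
  consider "u = v" | "u = \<sigma> v" "u \<noteq> v" | "u \<noteq> v" "u \<noteq> \<sigma> v" by blast
  then show ?thesis
  proof cases
    case 1
    then show ?thesis unfolding sum
      using assms self not_collinear_antipode[OF assms(2)] antipode_neq[OF assms(2)]
      by (simp add: adj_def rel_def)
  next
    case 2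
    have "\<not> collinear_pts Q (\<sigma> v) v"
      using not_collinear_antipode[OF assms(1)] antipode_antipode[OF assms(2)] 2 by simp
    moreover have "\<not> collinear_pts Q (\<sigma> v) (\<sigma> v)" by (simp add: collinear_pts_def)
    ultimately show ?thesis unfolding sum using 2 assms by (simp add: adj_def rel_def)
  next
    case 3
    then show ?thesis unfolding sum using assms not_both_collinear[OF assms]
      by (auto simp: adj_def rel_def)
  qed
qed

lemma sum_adj_4:
  assumes "u \<in> X"
  shows "(\<Sum>v\<in>X. adj Q H 4 u v * f v) = f (\<sigma> u)"
proof -
  \<comment> \<open>The involution property turns \<open>u = \<sigma> v\<close> into
    \<open>v = \<sigma> u\<close>, so row \<open>u\<close> has a single nonzero entry.\<close>
  have "adj Q H 4 u v * f v = (if v = \<sigma> u then f v else 0)" if "v \<in> X" for v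
    using assms that antipode_antipode by (auto simp: adj_def rel_def)
  then have "(\<Sum>v\<in>X. adj Q H 4 u v * f v) = (\<Sum>v\<in>X. if v = \<sigma> u then f v else 0)"
    by (intro sum.cong) auto
  then show ?thesis using antipode_in_X[OF assms] by simp
qed

section \<open>Consequences of the eigenvalue equations\<close>

lemma eigspace_antipode:
  assumes "f \<in> eigspace Q H i" "u \<in> X"
  shows "f (\<sigma> u) = eigenmatrix (real CARD('a)) i 4 * f u"
  using assms sum_adj_4[OF assms(2), of f] by (auto simp: eigspace_def)

text \<open>Adding the five eigenvalue equations at \<open>u\<close> applies the all-one matrix to
  \<open>f\<close>.\<close>

lemma eigspace_sum:
  assumes "f \<in> eigspace Q H i" "u \<in> X"
  shows "(\<Sum>v\<in>X. f v) = (\<Sum>k\<le>4. eigenmatrix (real CARD('a)) i k) * f u"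
proof -
  have "(\<Sum>v\<in>X. f v) = (\<Sum>v\<in>X. (\<Sum>k\<le>4. adj Q H k u v) * f v)"
    using assms by (intro sum.cong) (auto simp: sum_adj)
  also have "\<dots> = (\<Sum>k\<le>4. \<Sum>v\<in>X. adj Q H k u v * f v)"
    by (simp add: sum_distrib_right sum.swap[of _ X])
  also have "\<dots> = (\<Sum>k\<le>4. eigenmatrix (real CARD('a)) i k * f u)"
    using assms by (intro sum.cong) (auto simp: eigspace_def)
  finally show ?thesis by (simp add: sum_distrib_right)
qed

text \<open>Row 0 of the eigenmatrix has the nonzero sum q^2 (q^2 - 1), so the total of
  \<open>f\<close> determines its value at every point of \<open>X\<close>.\<close>

lemma eigspace_0_const:
  assumes "f \<in> eigspace Q H 0" "u \<in> X" "v \<in> X"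
  shows "f u = f v"
proof -
  let ?q = "real CARD('a)"
  have "(\<Sum>k\<le>4. eigenmatrix ?q 0 k) = ?q\<^sup>2 * (?q\<^sup>2 - 1)"
    by (simp add: eval_nat_numeral eigenmatrix_def algebra_simps)
  moreover have "?q > 1" using one_less_card_field[where 'a='a] by simp
  then have "?q\<^sup>2 * (?q\<^sup>2 - 1) > 0" by simp
  ultimately show ?thesis
    using eigspace_sum[OF assms(1,2)] eigspace_sum[OF assms(1,3)]
    by (metis less_irrefl mult_cancel_left)
qed

lemma eigspace_2_sum:
  assumes "f \<in> eigspace Q H 2" "u \<in> X"
  shows "(\<Sum>v\<in>X. f v) = 0"
proof -
  have "(\<Sum>k\<le>4. eigenmatrix (real CARD('a)) 2 k) = 0"
    by (simp add: eval_nat_numeral eigenmatrix_def)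
  then show ?thesis using eigspace_sum[OF assms] by simp
qed

lemma eigspace_outside: "f \<in> eigspace Q H i \<Longrightarrow> u \<notin> X \<Longrightarrow> f u = 0"
  by (simp add: eigspace_def)

section \<open>Sums of eigenspaces and characteristic vectors\<close>

lemma eigsum_023_decomposition:
  assumes "f \<in> eigsum Q H {0, 2, 3}"
  obtains g0 g2 g3 where "g0 \<in> eigspace Q H 0" "g2 \<in> eigspace Q H 2" "g3 \<in> eigspace Q H 3"
    "f = (\<lambda>u. g0 u + g2 u + g3 u)"
proof -
  from assms obtain g where "\<forall>i\<in>{0, 2, 3}. g i \<in> eigspace Q H i" "f = (\<lambda>u. \<Sum>i\<in>{0, 2, 3}. g i u)"
    unfolding eigsum_def by blast
  then show thesis by (intro that[of "g 0" "g 2" "g 3"]) (auto simp: add.assoc)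
qed

lemma eigsum_pair_iff:
  assumes "i \<noteq> j"
  shows "f \<in> eigsum Q H {i, j} \<longleftrightarrow>
    (\<exists>g\<in>eigspace Q H i. \<exists>h\<in>eigspace Q H j. f = (\<lambda>u. g u + h u))"
proof
  assume "f \<in> eigsum Q H {i, j}"
  then show "\<exists>g\<in>eigspace Q H i. \<exists>h\<in>eigspace Q H j. f = (\<lambda>u. g u + h u)"
    using assms by (auto simp: eigsum_def)
next
  assume "\<exists>g\<in>eigspace Q H i. \<exists>h\<in>eigspace Q H j. f = (\<lambda>u. g u + h u)"
  then obtain g h where "g \<in> eigspace Q H i" "h \<in> eigspace Q H j" "f = (\<lambda>u. g u + h u)" by blast
  then show "f \<in> eigsum Q H {i, j}"
    using assms by (auto simp: eigsum_def intro!: exI[of _ "\<lambda>k. if k = i then g else h"])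
qed

lemma eigspace_antipode_values:
  assumes "u \<in> X"
  shows "f \<in> eigspace Q H 0 \<Longrightarrow> f (\<sigma> u) = f u"
    and "f \<in> eigspace Q H 2 \<Longrightarrow> f (\<sigma> u) = f u"
    and "f \<in> eigspace Q H 3 \<Longrightarrow> f (\<sigma> u) = - f u"
  using eigspace_antipode[OF _ assms, of f] by (auto simp: eigenmatrix_def)

text \<open>As \<sigma> is an involution on \<open>X\<close>, invariance of the set can be tested
  pointwise, in the form to which the eigenvalues of the fourth adjacency matrix apply.\<close>

lemma antipode_image_eq_iff:
  assumes "Y \<subseteq> X"
  shows "\<sigma> ` Y = Y \<longleftrightarrow> (\<forall>u\<in>X. indicator Y (\<sigma> u) = (indicator Y u :: real))"
proof
  assume "\<sigma> ` Y = Y"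
  then have "\<sigma> u \<in> Y \<longleftrightarrow> u \<in> Y" if "u \<in> X" for u
    using that antipode_antipode by (metis image_eqI)
  then show "\<forall>u\<in>X. indicator Y (\<sigma> u) = (indicator Y u :: real)"
    by (simp add: indicator_def)
next
  assume "\<forall>u\<in>X. indicator Y (\<sigma> u) = (indicator Y u :: real)"
  then have "\<sigma> u \<in> Y \<longleftrightarrow> u \<in> Y" if "u \<in> X" for u
    using that by (auto simp: indicator_def split: if_splits)
  then show "\<sigma> ` Y = Y"
    using assms antipode_antipode by (auto simp: image_iff) (metis subset_iff)
qed

text \<open>The two points are distinct, so their contributions add. This makes the counting
  condition linear in the characteristic vector.\<close>

lemma card_antipodal_pair:
  assumes "p \<in> X"
  shows "real (card (Y \<inter> {p, \<sigma> p})) = indicator Y p + indicator Y (\<sigma> p)"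
  using antipode_neq[OF assms] by (auto simp: indicator_def Int_insert_right)

section \<open>The two equivalences\<close>

theorem eigsum_02_iff:
  assumes "Y \<subseteq> X" and "indicator Y \<in> eigsum Q H {0, 2, 3}"
  shows "indicator Y \<in> eigsum Q H {0, 2} \<longleftrightarrow> \<sigma> ` Y = Y"
proof
  assume "indicator Y \<in> eigsum Q H {0, 2}"
  then show "\<sigma> ` Y = Y"
    unfolding antipode_image_eq_iff[OF assms(1)]
    by (auto simp: eigsum_pair_iff eigspace_antipode_values)
next
  assume Y: "\<sigma> ` Y = Y"
  obtain g0 g2 g3 where g: "g0 \<in> eigspace Q H 0" "g2 \<in> eigspace Q H 2" "g3 \<in> eigspace Q H 3"
    and eq: "indicator Y = (\<lambda>u. g0 u + g2 u + g3 u)"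
    using eigsum_023_decomposition[OF assms(2)] .
  \<comment> \<open>Comparing the values at \<open>u\<close> and \<open>\<sigma> u\<close> cancels
    \<open>g0\<close> and \<open>g2\<close> and leaves \<open>g3 u = - g3 u\<close>.\<close>
  have "g3 u = 0" for u
  proof (cases "u \<in> X")
    case True
    then show ?thesis
      using Y g unfolding antipode_image_eq_iff[OF assms(1)] eq
      by (auto simp: eigspace_antipode_values)
  qed (simp add: eigspace_outside[OF g(3)])
  then show "indicator Y \<in> eigsum Q H {0, 2}"
    using g by (auto simp: eigsum_pair_iff eq)
qed

theorem eigsum_03_iff:
  assumes "Y \<subset> X" "Y \<noteq> {}" and "indicator Y \<in> eigsum Q H {0, 2, 3}"
  shows "indicator Y \<in> eigsum Q H {0, 3} \<longleftrightarrow> (\<forall>p\<in>X. card (Y \<inter> {p, \<sigma> p}) = 1)"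
proof
  assume "indicator Y \<in> eigsum Q H {0, 3}"
  then obtain g0 g3 where g: "g0 \<in> eigspace Q H 0" "g3 \<in> eigspace Q H 3"
    and eq: "indicator Y = (\<lambda>u. g0 u + g3 u)"
    by (auto simp: eigsum_pair_iff)
  obtain y z where yz: "y \<in> Y" "z \<in> X" "z \<notin> Y" using assms by blast
  \<comment> \<open>Over an antipodal pair the values of \<open>g3\<close> cancel, and
    \<open>g0\<close> is constant, so all pairs meet \<open>Y\<close> equally often. A point in
    \<open>Y\<close> forces at least 1, a point of \<open>X\<close> outside \<open>Y\<close> at most
    1.\<close>
  have card: "real (card (Y \<inter> {p, \<sigma> p})) = 2 * g0 y" if "p \<in> X" for p
    using that yz assms(1) g eigspace_0_const[OF g(1) that, of y]
    unfolding card_antipodal_pair[OF that] eq by (auto simp: eigspace_antipode_values)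
  have "y \<in> X" using yz assms(1) by blast
  have "real (card (Y \<inter> {y, \<sigma> y})) \<ge> 1"
    using yz unfolding card_antipodal_pair[OF \<open>y \<in> X\<close>] by (simp add: indicator_def)
  moreover have "real (card (Y \<inter> {z, \<sigma> z})) \<le> 1"
    using yz unfolding card_antipodal_pair[OF \<open>z \<in> X\<close>] by (simp add: indicator_def)
  ultimately have "card (Y \<inter> {y, \<sigma> y}) = 1"
    using card[OF \<open>y \<in> X\<close>] card[OF \<open>z \<in> X\<close>] by linarith
  then have "2 * g0 y = 1" using card[OF \<open>y \<in> X\<close>] by simp
  then show "\<forall>p\<in>X. card (Y \<inter> {p, \<sigma> p}) = 1" using card by simp
next
  assume one: "\<forall>p\<in>X. card (Y \<inter> {p, \<sigma> p}) = 1"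
  obtain g0 g2 g3 where g: "g0 \<in> eigspace Q H 0" "g2 \<in> eigspace Q H 2" "g3 \<in> eigspace Q H 3"
    and eq: "indicator Y = (\<lambda>u. g0 u + g2 u + g3 u)"
    using eigsum_023_decomposition[OF assms(3)] .
  obtain y where y: "y \<in> X" using assms by blast
  \<comment> \<open>The antipodal pair has total 1; \<open>g3\<close> cancels, and \<open>g0\<close>
    and \<open>g2\<close> each count twice.\<close>
  have half: "g0 u + g2 u = 1 / 2" if "u \<in> X" for u
    using one that card_antipodal_pair[OF that, of Y] g unfolding eq
    by (auto simp: eigspace_antipode_values)
  have const: "g2 u = g2 y" if "u \<in> X" for u
    using half[OF that] half[OF y] eigspace_0_const[OF g(1) that y] by simp
  \<comment> \<open>A constant function with zero sum over the nonempty set \<open>X\<close>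
    vanishes.\<close>
  have "real (card X) * g2 y = (\<Sum>v\<in>X. g2 v)" using const by simp
  also have "\<dots> = 0" using eigspace_2_sum[OF g(2) y] .
  finally have "g2 y = 0" using y by (auto simp: card_eq_0_iff)
  then have "g2 u = 0" for u using const eigspace_outside[OF g(2)] by (cases "u \<in> X") auto
  then show "indicator Y \<in> eigsum Q H {0, 3}"
    using g by (auto simp: eigsum_pair_iff eq)
qed

end

theorem theorem4p5:
  fixes Q :: "'a::{field,finite} ^ 6 \<Rightarrow> 'a" and H :: "'a subsp" and Y :: "'a subsp set"
  assumes "CARD('a) > 2"
    and "elliptic_form Q"
    and "parabolic_hyperplane Q H"
    and "Y \<subset> X_set Q H" and "Y \<noteq> {}"
    and "indicator Y \<in> eigsum Q H {0, 2, 3}"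
  shows "(indicator Y \<in> eigsum Q H {0, 2} \<longleftrightarrow> antipode Q H ` Y = Y) \<and>
    (indicator Y \<in> eigsum Q H {0, 3} \<longleftrightarrow> (\<forall>p\<in>X_set Q H. card (Y \<inter> {p, antipode Q H p}) = 1))"
proof -
  interpret quadratic_space Q
    using assms(2) by unfold_locales (simp add: elliptic_form_def)
  obtain n where "perp Q H = vec.span {n}" "Q n \<noteq> 0" "H = {v. B n v = 0}"
    using parabolic_hyperplane_pole assms(2,3) by (auto simp: elliptic_form_def)
  then interpret hyperplane_pole Q H n by unfold_locales
  show ?thesis using eigsum_02_iff eigsum_03_iff assms(4-6) by blast
qed

end
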